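(* Consider the unit-demand Euclidean CVRP with any finite set $V$ of $n$ terminals in $\mathbb{R}^2$, any depot $O\in\mathbb{R}^2$ and any capacity $k\in\mathbb{N}^+$, and let $\mathrm{opt}$ be the cost of an optimal solution. Then for every $R\in\mathbb{R}^+\cup\{0,\infty\}$, \[\mathrm{opt}\ge T^*_R+\mathrm{rad}_R-\frac{3\pi D}{2},\] where $D$ is the diameter of $V\cup\{O\}$.
   Context: Unit-demand Euclidean CVRP: a solution is a set of tours, each a closed curve starting and ending at $O$ visiting at most $k$ terminals, with every terminal visited by some tour; cost is total Euclidean length. For $R\in\mathbb{R}^+\cup\{0,\infty\}$: the $R$-radial cost is $\mathrm{rad}_R:=\frac{2}{k}\sum_{v\in V}\min\{d(O,v),R\}$, and the $R$-local cost $T^*_R$ is the minimum length of a traveling salesman tour on the point set $\{v\in V: d(O,v)\ge R\}$ (taken to be $0$ if this set has at most one point). $d$ denotes Euclidean distance. *)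

theory Defs
  imports "HOL-Analysis.Analysis" "HOL-Library.Extended_Real"
begin

type_synonym point = "real ^ 2"

fun path_len :: "point list \<Rightarrow> real" where
  "path_len (x # y # xs) = dist x y + path_len (y # xs)"
| "path_len _ = 0"

definition tour_cost :: "point \<Rightarrow> point list \<Rightarrow> real" where
  "tour_cost Ob t = path_len (Ob # t @ [Ob])"

definition cvrp_feasible :: "point set \<Rightarrow> nat \<Rightarrow> point list list \<Rightarrow> bool" where
  "cvrp_feasible V k sol \<longleftrightarrow>
     (\<forall>t\<in>set sol. set t \<subseteq> V \<and> card (set t) \<le> k) \<and> V \<subseteq> (\<Union>t\<in>set sol. set t)"

definition cvrp_cost :: "point \<Rightarrow> point list list \<Rightarrow> real" where
  "cvrp_cost Ob sol = sum_list (map (tour_cost Ob) sol)"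

definition cvrp_opt :: "point set \<Rightarrow> point \<Rightarrow> nat \<Rightarrow> real" where
  "cvrp_opt V Ob k = Inf {cvrp_cost Ob sol | sol. cvrp_feasible V k sol}"

definition cycle_len :: "point list \<Rightarrow> real" where
  "cycle_len xs = path_len (xs @ [hd xs])"

definition tsp_len :: "point set \<Rightarrow> real" where
  "tsp_len S = (if card S \<le> 1 then 0
                else Inf {cycle_len xs | xs. distinct xs \<and> set xs = S})"

definition local_cost :: "point set \<Rightarrow> point \<Rightarrow> ereal \<Rightarrow> real" where
  "local_cost V Ob R = tsp_len {v \<in> V. R \<le> ereal (dist Ob v)}"

definition radial_cost :: "point set \<Rightarrow> point \<Rightarrow> nat \<Rightarrow> ereal \<Rightarrow> real" where
  "radial_cost V Ob k R = 2 / real k * (\<Sum>v\<in>V. real_of_ereal (min (ereal (dist Ob v)) R))"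

end

theory Submission
  imports Defs "HOL-Library.Sublist" "HOL-Library.Multiset"
begin

text \<open>
  Shortcut every tour to its terminals at distance at least \<open>R\<close> from the depot. If such terminals
  remain, cut off the first and the last radial segment of length \<open>R\<close>; these two pieces pay for the
  radial cost of the at most \<open>k\<close> terminals of the tour. What is left is a path whose two ends lie on
  the circle of radius \<open>R\<close>. All these ends also lie in the convex hull of \<open>V \<union> {O}\<close>, so the
  polygon through them in cyclic order has diameter at most \<open>D\<close>, and by Cauchy's projection formula
  perimeter at most \<open>\<pi> D\<close>. The paths, the polygon, and the cheaper one of the two perfect matchings
  formed by alternate polygon edges together form a connected even multigraph. Its Euler tour visits
  all far terminals and costs at most \<open>3 \<pi> D / 2\<close> more than the paths.
\<close>

subsection \<open>Walks and tours\<close>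

lemma path_len_Cons: "xs \<noteq> [] \<Longrightarrow> path_len (x # xs) = dist x (hd xs) + path_len xs"
  by (cases xs) auto

lemma path_len_nonneg: "0 \<le> path_len xs"
  by (induction xs rule: path_len.induct) auto

lemma path_len_append_last:
  "xs \<noteq> [] \<Longrightarrow> path_len (xs @ ys) = path_len xs + path_len (last xs # ys)"
  by (induction xs rule: path_len.induct) auto

lemma path_len_append_hd:
  "ys \<noteq> [] \<Longrightarrow> path_len (xs @ ys) = path_len (xs @ [hd ys]) + path_len ys"
  using path_len_append_last[of "xs @ [hd ys]" "tl ys"] by simp

lemma path_len_rev: "path_len (rev xs) = path_len xs"
proof (induction xs rule: path_len.induct)
  case (1 x y xs)
  then show ?case
    using path_len_append_last[of "rev xs @ [y]" "[x]"] by (simp add: dist_commute)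
qed auto

lemma path_len_Cons_triangle: "path_len (x # xs) \<le> dist x y + path_len (y # xs)"
  by (cases xs) (auto intro: dist_triangle)

text \<open>The triangle inequality pays for bypassing a skipped element \<open>y\<close>. The start
  \<open>x\<close> stays arbitrary because \<open>y\<close> is the start in the induction
  hypothesis.\<close>

lemma path_len_Cons_subseq: "subseq xs ys \<Longrightarrow> path_len (x # xs) \<le> path_len (x # ys)"
proof (induction xs ys arbitrary: x rule: list_emb.induct)
  case (list_emb_Nil ys)
  then show ?case using path_len_nonneg by simp
next
  case (list_emb_Cons xs ys y)
  show ?case
    using path_len_Cons_triangle[of x xs y] list_emb_Cons.IH[of y] by simp
next
  case (list_emb_Cons2 y z xs ys)
  then show ?case by simp
qed

lemma tour_cost_subseq: "subseq s t \<Longrightarrow> tour_cost Ob s \<le> tour_cost Ob t"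
  unfolding tour_cost_def by (auto intro!: path_len_Cons_subseq list_emb_append_mono)

lemma tour_cost_eq:
  "t \<noteq> [] \<Longrightarrow> tour_cost Ob t = dist Ob (hd t) + path_len t + dist (last t) Ob"
  unfolding tour_cost_def using path_len_append_last[of t "[Ob]"]
  by (simp add: path_len_Cons)

text \<open>Shortcutting the tour to \<open>v\<close> alone leaves the trip from the depot to
  \<open>v\<close> and back.\<close>

lemma tour_cost_ge_dist:
  assumes "v \<in> set t"
  shows "2 * dist Ob v \<le> tour_cost Ob t"
  using tour_cost_subseq[of "[v]" t Ob] assms
  by (simp add: tour_cost_eq subseq_singleton_left dist_commute)

lemma tour_cost_nonneg: "0 \<le> tour_cost Ob t"
  unfolding tour_cost_def by (rule path_len_nonneg)

text \<open>The closing edge is no longer than the detour from \<open>last t\<close> to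
  \<open>hd t\<close> through the depot.\<close>

lemma cycle_len_le_tour_cost: "cycle_len t \<le> tour_cost Ob t"
proof (cases "t = []")
  case True
  then show ?thesis by (simp add: cycle_len_def tour_cost_nonneg)
next
  case False
  then show ?thesis
    using dist_triangle[of "last t" "hd t" Ob]
    by (simp add: tour_cost_eq cycle_len_def path_len_append_last)
qed

section \<open>Shortcutting closed walks to salesman tours\<close>

lemma remdups_subseq: "subseq (remdups xs) xs"
  by (induction xs) auto

text \<open>Keeping one visit to each point of \<open>S\<close> in the walk gives a salesman tour
  that is no longer.\<close>

lemma tsp_len_le_closed_walk:
  assumes "w \<noteq> []" "hd w = last w" "S \<subseteq> set w"
  shows "tsp_len S \<le> path_len w"
proof (cases "card S \<le> 1")
  case True
  then show ?thesis by (simp add: tsp_len_def path_len_nonneg)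
next
  case False
  define xs where "xs = remdups (filter (\<lambda>v. v \<in> S) w)"
  have xs: "distinct xs" "set xs = S" using assms by (auto simp: xs_def)
  have "subseq xs w"
    unfolding xs_def by (metis subseq_order.trans subseq_filter_left remdups_subseq)
  \<comment> \<open>The base point \<open>a\<close> of the walk acts as depot: as \<open>w\<close>
    starts and ends there, the two extra legs of \<open>tour_cost a w\<close> have length 0.\<close>
  obtain a m where w: "w = a # m" using assms by (cases w) auto
  have "cycle_len xs \<le> tour_cost a xs" by (rule cycle_len_le_tour_cost)
  also have "\<dots> \<le> tour_cost a w" using \<open>subseq xs w\<close> by (rule tour_cost_subseq)
  also have "\<dots> = path_len w"
    using assms w by (simp add: tour_cost_eq)
  finally have "cycle_len xs \<le> path_len w" .
  moreover have "bdd_below {cycle_len xs | xs. distinct xs \<and> set xs = S}"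
    by (rule bdd_belowI[of _ 0]) (auto simp: cycle_len_def path_len_nonneg)
  then have "Inf {cycle_len xs | xs. distinct xs \<and> set xs = S} \<le> cycle_len xs"
    by (rule cInf_lower[rotated]) (use xs in auto)
  ultimately show ?thesis using False by (simp add: tsp_len_def)
qed

section \<open>Euler tours in even multigraphs of paths\<close>

definition ends :: "'a list \<Rightarrow> 'a multiset" where
  "ends p = {#hd p, last p#}"

lemma ends_rev: "p \<noteq> [] \<Longrightarrow> ends (rev p) = ends p"
  by (simp add: ends_def hd_rev last_rev)

text \<open>The walk \<open>w\<close> plays the role of a connected component containing all endpoints: closed paths are
  spliced into it, and an open path is first joined to another one sharing its last point.\<close>

lemma euler_walk:
  fixes P :: "point list multiset"
  assumes "\<And>p. p \<in># P \<Longrightarrow> p \<noteq> []"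
    and "\<And>x. even (count (\<Sum>p\<in>#P. ends p) x)"
    and "\<And>p. p \<in># P \<Longrightarrow> set_mset (ends p) \<subseteq> set w"
  shows "\<exists>w'. (w \<noteq> [] \<longrightarrow> w' \<noteq> []) \<and> hd w' = hd w \<and> last w' = last w \<and>
           set w \<union> (\<Union>p\<in>set_mset P. set p) \<subseteq> set w' \<and>
           path_len w' = path_len w + (\<Sum>p\<in>#P. path_len p)"
  using assms
proof (induction "size P" arbitrary: P w rule: less_induct)
  case less
  show ?case
  proof (cases "P = {#}")
    case True
    then show ?thesis by (intro exI[of _ w]) auto
  next
    case False
    then obtain p Q where P: "P = add_mset p Q" by (meson multiset_cases)
    have p: "p \<noteq> []" using less.prems(1) P by auto
    show ?thesis
    proof (cases "hd p = last p")
      case True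
      have "hd p \<in> set w" using less.prems(3)[of p] P by (auto simp: ends_def)
      then obtain xs ys where w: "w = xs @ hd p # ys" by (meson split_list)
      define u where "u = xs @ p @ ys"
      have len: "path_len u = path_len w + path_len p"
        unfolding u_def w
        using p True path_len_append_hd[of "p @ ys" xs] path_len_append_last[of p ys]
          path_len_append_last[of "xs @ [hd p]" ys]
        by simp
      have su: "set u = set w \<union> set p" using p by (auto simp: u_def w)
      have hu: "hd u = hd w" using p by (cases xs) (auto simp: u_def w)
      have lu: "last u = last w" using p True by (cases ys) (auto simp: u_def w)
      have une: "u \<noteq> []" using p by (simp add: u_def)
      \<comment> \<open>A closed path counts its base point twice, so removing it preserves all
        parities.\<close>
      have ev: "even (count (\<Sum>p\<in>#Q. ends p) x)" for x
      proof -
        have "even (count (ends p) x)" using True by (simp add: ends_def)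
        then show ?thesis using less.prems(2)[of x] by (simp add: P)
      qed
      have "\<exists>w'. (u \<noteq> [] \<longrightarrow> w' \<noteq> []) \<and> hd w' = hd u \<and> last w' = last u \<and>
           set u \<union> (\<Union>p\<in>set_mset Q. set p) \<subseteq> set w' \<and>
           path_len w' = path_len u + (\<Sum>p\<in>#Q. path_len p)"
      proof (rule less.hyps)
        show "set_mset (ends q) \<subseteq> set u" if "q \<in># Q" for q
          using less.prems(3)[of q] that su by (auto simp: P)
      qed (use less.prems(1) ev in \<open>auto simp: P\<close>)
      then obtain w' where "w' \<noteq> []" "hd w' = hd u" "last w' = last u"
           "set u \<union> (\<Union>p\<in>set_mset Q. set p) \<subseteq> set w'"
           "path_len w' = path_len u + (\<Sum>p\<in>#Q. path_len p)"
        using une by auto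
      then show ?thesis
        using hu lu su len by (intro exI[of _ w']) (auto simp: P)
    next
      case False
      let ?x = "last p"
      \<comment> \<open>Only one end of \<open>p\<close> lies at \<open>?x\<close>, so evenness
        forces some path of \<open>Q\<close> to end there too.\<close>
      have "even (count (ends p) ?x + count (\<Sum>p\<in>#Q. ends p) ?x)"
        using less.prems(2)[of ?x] by (simp add: P)
      moreover have "count (ends p) ?x = 1" using False by (simp add: ends_def)
      ultimately have "count (\<Sum>p\<in>#Q. ends p) ?x \<noteq> 0" by (metis even_add odd_one even_zero)
      then have "?x \<in># (\<Sum>p\<in>#Q. ends p)" by (metis not_in_iff)
      then obtain q0 where q0: "q0 \<in># Q" "?x \<in># ends q0" by auto
      then obtain Q' where Q: "Q = add_mset q0 Q'" by (meson multi_member_split)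
      have q0ne: "q0 \<noteq> []" using less.prems(1) q0 P by auto
      define q where "q = (if hd q0 = ?x then q0 else rev q0)"
      have q: "q \<noteq> []" "hd q = ?x" "ends q = ends q0" "set q = set q0" "path_len q = path_len q0"
        using q0 q0ne by (auto simp: q_def ends_rev path_len_rev hd_rev last_rev ends_def)
      define r where "r = p @ tl q"
      have r: "r \<noteq> []" "hd r = hd p" "last r = last q" "set r = set p \<union> set q"
        "path_len r = path_len p + path_len q"
      proof -
        obtain q' where q': "q = ?x # q'" using q by (cases q) auto
        show "r \<noteq> []" "hd r = hd p" "last r = last q"
          using p q' by (auto simp: r_def)
        have "?x \<in> set p" using p by simp
        then show "set r = set p \<union> set q" by (subst q', subst r_def, subst q') auto
        show "path_len r = path_len p + path_len q"
          using path_len_append_last[OF p, of q'] q' by (metis list.sel(3) r_def)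
      qed
      \<comment> \<open>Joining uses up two ends at \<open>?x\<close>, which keeps every parity, and
        leaves one path fewer.\<close>
      have er: "ends p + ends q = ends r + {#?x, ?x#}"
        using r q by (simp add: ends_def)
      have ev: "even (count (\<Sum>p\<in>#add_mset r Q'. ends p) x)" for x
      proof -
        have "count (\<Sum>p\<in>#P. ends p) x = count (ends p + ends q) x + count (\<Sum>p\<in>#Q'. ends p) x"
          by (simp add: P Q q)
        also have "\<dots> = count (\<Sum>p\<in>#add_mset r Q'. ends p) x + count {#?x, ?x#} x"
          unfolding er by simp
        finally have "even (count (\<Sum>p\<in>#add_mset r Q'. ends p) x + count {#?x, ?x#} x)"
          using less.prems(2)[of x] by simp
        then show ?thesis by (auto split: if_splits)
      qed
      have "\<exists>w'. (w \<noteq> [] \<longrightarrow> w' \<noteq> []) \<and> hd w' = hd w \<and> last w' = last w \<and>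
           set w \<union> (\<Union>p\<in>set_mset (add_mset r Q'). set p) \<subseteq> set w' \<and>
           path_len w' = path_len w + (\<Sum>p\<in>#add_mset r Q'. path_len p)"
      proof (rule less.hyps)
        show "set_mset (ends s) \<subseteq> set w" if "s \<in># add_mset r Q'" for s
        proof (cases "s = r")
          case True
          have "set_mset (ends r) \<subseteq> set_mset (ends p) \<union> set_mset (ends q)"
            using r by (auto simp: ends_def)
          then show ?thesis using less.prems(3)[of p] less.prems(3)[of q0] q True by (auto simp: P Q)
        next
          case False
          then show ?thesis using less.prems(3)[of s] that by (auto simp: P Q)
        qed
        show "size (add_mset r Q') < size P" by (simp add: P Q)
        show "s \<noteq> []" if "s \<in># add_mset r Q'" for s
          using that less.prems(1) r by (auto simp: P Q)
      qed (rule ev)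
      then show ?thesis using r q by (auto simp: P Q)
    qed
  qed
qed

section \<open>Matchings from alternate polygon edges\<close>

fun pairing :: "'a list \<Rightarrow> 'a list list" where
  "pairing (x # y # zs) = [x, y] # pairing zs"
| "pairing _ = []"

text \<open>The edges at odd and at even positions partition the edges of the path.\<close>

lemma sum_pairing:
  "(\<Sum>p\<leftarrow>pairing cs. path_len p) + (\<Sum>p\<leftarrow>pairing (tl cs). path_len p) = path_len cs"
proof (induction cs)
  case (Cons x cs)
  then show ?case by (cases cs) auto
qed simp

lemma pairing_snoc: "even (length cs) \<Longrightarrow> pairing (cs @ [x]) = pairing cs"
  by (induction cs rule: pairing.induct) auto

lemma ends_pairing: "even (length cs) \<Longrightarrow> (\<Sum>p\<leftarrow>pairing cs. ends p) = mset cs"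
  by (induction cs rule: pairing.induct) (auto simp: ends_def)

lemma pairing_nonempty: "p \<in> set (pairing cs) \<Longrightarrow> p \<noteq> [] \<and> set p \<subseteq> set cs"
  by (induction cs rule: pairing.induct) auto

text \<open>A closed polygon with an even number of vertices is the union of two perfect matchings,
  so the cheaper one has at most half its length.\<close>

lemma short_matching:
  assumes "even (length cs)"
  obtains M where "(\<Sum>p\<leftarrow>M. ends p) = mset cs" "(\<Sum>p\<leftarrow>M. path_len p) \<le> cycle_len cs / 2"
    "\<And>p. p \<in> set M \<Longrightarrow> p \<noteq> [] \<and> set p \<subseteq> set cs"
proof (cases "cs = []")
  case True
  then show ?thesis using that[of "[]"] by (simp add: cycle_len_def)
next
  case False
  \<comment> \<open>Rotation by one vertex turns \<open>pairing\<close> into the other matching,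
    which contains the closing edge.\<close>
  let ?ds = "tl cs @ [hd cs]"
  have ds: "even (length ?ds)" "mset ?ds = mset cs" "set ?ds = set cs"
    using assms False by (cases cs; simp)+
  \<comment> \<open>In \<open>cs @ [hd cs]\<close> the repeated first vertex is left over by
    \<open>pairing\<close>, since its length is odd.\<close>
  have "(\<Sum>p\<leftarrow>pairing cs. path_len p) + (\<Sum>p\<leftarrow>pairing ?ds. path_len p) = cycle_len cs"
    using sum_pairing[of "cs @ [hd cs]"] False assms by (simp add: cycle_len_def pairing_snoc)
  then consider "(\<Sum>p\<leftarrow>pairing cs. path_len p) \<le> cycle_len cs / 2" |
     "(\<Sum>p\<leftarrow>pairing ?ds. path_len p) \<le> cycle_len cs / 2" by linarith
  then show ?thesis
  proof cases
    case 1
    then show ?thesis using that[of "pairing cs"] ends_pairing[OF assms] pairing_nonempty by blast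
  next
    case 2
    show ?thesis using that[OF _ 2] ends_pairing[OF ds(1)] pairing_nonempty[of _ ?ds] ds(2,3) by metis
  qed
qed

text \<open>The paths and the matching have the same multiset of ends, so together all counts are
  even. The polygon, of cost 1 in units of its length, provides connectivity; the matching adds at
  most 1/2.\<close>

lemma walk_through_paths:
  fixes P :: "point list list"
  assumes ne: "\<And>p. p \<in> set P \<Longrightarrow> p \<noteq> []"
    and cs: "mset cs = (\<Sum>p\<leftarrow>P. ends p)" and "P \<noteq> []"
  obtains w where "w \<noteq> []" "hd w = last w" "(\<Union>p\<in>set P. set p) \<subseteq> set w"
    "path_len w \<le> (\<Sum>p\<leftarrow>P. path_len p) + 3 / 2 * cycle_len cs"
proof -
  have "size (\<Sum>p\<leftarrow>P. ends p) = 2 * length P" by (induction P) (auto simp: ends_def)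
  then have len: "length cs = 2 * length P" by (metis cs size_mset)
  then have csne: "cs \<noteq> []" using \<open>P \<noteq> []\<close> by auto
  obtain M where M: "(\<Sum>p\<leftarrow>M. ends p) = mset cs" "(\<Sum>p\<leftarrow>M. path_len p) \<le> cycle_len cs / 2"
    "\<And>p. p \<in> set M \<Longrightarrow> p \<noteq> [] \<and> set p \<subseteq> set cs"
    using short_matching[of cs] len by auto
  \<comment> \<open>The closed polygon is the initial walk: it meets every end, and its length
    enters through \<open>path_len ?w\<close> rather than through \<open>?P\<close>.\<close>
  let ?w = "cs @ [hd cs]"
  let ?P = "mset P + mset M"
  have sm: "(\<Sum>p\<in>#mset Q. f p) = (\<Sum>p\<leftarrow>Q. f p)" for Q and f :: "point list \<Rightarrow> 'b::comm_monoid_add"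
    by (metis mset_map sum_mset_sum_list)
  have endsP: "set_mset (ends p) \<subseteq> set cs" if "p \<in> set P" for p
  proof -
    have "set_mset (ends p) \<subseteq> set_mset (\<Sum>p\<leftarrow>P. ends p)" using that by (induction P) auto
    then show ?thesis by (metis cs set_mset_mset)
  qed
  have "\<exists>w'. (?w \<noteq> [] \<longrightarrow> w' \<noteq> []) \<and> hd w' = hd ?w \<and> last w' = last ?w \<and>
           set ?w \<union> (\<Union>p\<in>set_mset ?P. set p) \<subseteq> set w' \<and>
           path_len w' = path_len ?w + (\<Sum>p\<in>#?P. path_len p)"
  proof (rule euler_walk)
    show "p \<noteq> []" if "p \<in># ?P" for p using that ne M(3) by auto
    show "even (count (\<Sum>p\<in>#?P. ends p) x)" for x
      by (simp add: sm M(1) cs[symmetric])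
    show "set_mset (ends p) \<subseteq> set ?w" if "p \<in># ?P" for p
    proof (cases "p \<in> set P")
      case True
      then show ?thesis using endsP by auto
    next
      case False
      then have "p \<noteq> []" "set p \<subseteq> set cs" using that M(3)[of p] by auto
      then have "hd p \<in> set cs" "last p \<in> set cs" by auto
      then show ?thesis by (simp add: ends_def)
    qed
  qed
  then obtain w where w: "w \<noteq> []" "hd w = hd cs" "last w = hd cs"
     "(\<Union>p\<in>set P. set p) \<subseteq> set w"
     "path_len w = cycle_len cs + ((\<Sum>p\<leftarrow>P. path_len p) + (\<Sum>p\<leftarrow>M. path_len p))"
    using csne by (auto simp: cycle_len_def sm)
  show ?thesis
    by (rule that[of w]) (use w M(2) in auto)
qed

subsection \<open>Perimeter of a polygon inscribed in a circle\<close>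

text \<open>This is \<open>path_len\<close> with an arbitrary edge weight, so that true and
  projected lengths along one list of angles can be compared by linearity.\<close>

fun chain_sum :: "('a \<Rightarrow> 'a \<Rightarrow> real) \<Rightarrow> 'a list \<Rightarrow> real" where
  "chain_sum w (x # y # xs) = w x y + chain_sum w (y # xs)"
| "chain_sum w _ = 0"

lemma path_len_map: "path_len (map g ts) = chain_sum (\<lambda>s t. dist (g s) (g t)) ts"
proof (induction ts)
  case (Cons x ts)
  then show ?case by (cases ts) auto
qed simp

lemma chain_sum_mult: "c * chain_sum w ts = chain_sum (\<lambda>s t. c * w s t) ts"
proof (induction ts)
  case (Cons x ts)
  then show ?case by (cases ts) (auto simp: algebra_simps)
qed simp

lemma chain_sum_append:
  "ts \<noteq> [] \<Longrightarrow> chain_sum w (ts @ [x]) = chain_sum w ts + w (last ts) x"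
proof (induction ts)
  case (Cons y ts)
  then show ?case by (cases ts) auto
qed simp

lemma has_integral_chain_sum:
  assumes "\<And>s t. ((\<lambda>x. w x s t) has_integral I s t) S"
  shows "((\<lambda>x. chain_sum (w x) ts) has_integral chain_sum I ts) S"
proof (induction ts)
  case (Cons x ts)
  then show ?case using assms by (cases ts) (auto intro!: has_integral_add)
qed simp

text \<open>Each weight is dominated by the increment of the potential \<open>h\<close>, and these
  increments telescope.\<close>

lemma chain_sum_le_telescope:
  fixes h :: "real \<Rightarrow> real"
  assumes "\<And>s t. s \<in> set ts \<Longrightarrow> t \<in> set ts \<Longrightarrow> s \<le> t \<Longrightarrow> w s t \<le> h t - h s"
    and "sorted ts" "ts \<noteq> []"
  shows "chain_sum w ts \<le> h (last ts) - h (hd ts)"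
  using assms
proof (induction ts)
  case (Cons x ts)
  show ?case
  proof (cases ts)
    case (Cons y zs)
    have "chain_sum w ts \<le> h (last ts) - h (hd ts)"
      by (rule Cons.IH) (use Cons.prems Cons in auto)
    moreover have "w x y \<le> h y - h x"
      using Cons.prems Cons by auto
    ultimately show ?thesis using Cons by simp
  qed simp
qed simp

text \<open>One full turn consists of a rise to \<open>a\<close>, a fall to \<open>b\<close> and a
  rise back to the starting value, so the variation is twice the drop from \<open>a\<close> to
  \<open>b\<close>.\<close>

lemma cyclic_variation:
  fixes f :: "real \<Rightarrow> real"
  assumes ord: "0 \<le> a" "a \<le> b" "b \<le> c"
    and inc1: "\<And>s t. 0 \<le> s \<Longrightarrow> s \<le> t \<Longrightarrow> t \<le> a \<Longrightarrow> f s \<le> f t"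
    and dec: "\<And>s t. a \<le> s \<Longrightarrow> s \<le> t \<Longrightarrow> t \<le> b \<Longrightarrow> f t \<le> f s"
    and inc2: "\<And>s t. b \<le> s \<Longrightarrow> s \<le> t \<Longrightarrow> t \<le> c \<Longrightarrow> f s \<le> f t"
    and per: "f c = f 0"
    and ts: "sorted ts" "ts \<noteq> []" "set ts \<subseteq> {0..c}" "\<And>t. t \<in> set ts \<Longrightarrow> l \<le> f t \<and> f t \<le> u"
  shows "chain_sum (\<lambda>s t. \<bar>f s - f t\<bar>) (ts @ [hd ts]) \<le> 2 * (u - l)"
proof -
  \<comment> \<open>\<open>h\<close> is the variation function of \<open>f\<close> clamped to \<open>[l, u]\<close>; clamping bounds its values at the
    turning points \<open>a\<close> and \<open>b\<close>, which need not occur in \<open>ts\<close>.\<close>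
  define g where "g t = max l (min u (f t))" for t
  define h where "h t = (if t \<le> a then g t else if t \<le> b then 2 * g a - g t
    else 2 * g a - 2 * g b + g t)" for t
  have g1: "g s \<le> g t" if "0 \<le> s" "s \<le> t" "t \<le> a" for s t
    using inc1[OF that] by (auto simp: g_def)
  have g2: "g t \<le> g s" if "a \<le> s" "s \<le> t" "t \<le> b" for s t
    using dec[OF that] by (auto simp: g_def)
  have g3: "g s \<le> g t" if "b \<le> s" "s \<le> t" "t \<le> c" for s t
    using inc2[OF that] by (auto simp: g_def)
  have key: "\<bar>g s - g t\<bar> \<le> h t - h s" if "0 \<le> s" "s \<le> t" "t \<le> c" for s t
  proof -
    consider "t \<le> a" | "s \<le> a" "a < t" "t \<le> b" | "s \<le> a" "b < t"
      | "a < s" "t \<le> b" | "a < s" "s \<le> b" "b < t" | "b < s"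
      using ord by linarith
    then show ?thesis
    proof cases
      case 1
      then show ?thesis using g1[of s t] that by (simp add: h_def)
    next
      case 2
      then show ?thesis using g1[of s a] g2[of a t] that ord by (simp add: h_def)
    next
      case 3
      then show ?thesis using g1[of s a] g2[of a b] g3[of b t] that ord by (simp add: h_def)
    next
      case 4
      then show ?thesis using g2[of s t] that ord by (simp add: h_def)
    next
      case 5
      then show ?thesis using g2[of s b] g3[of b t] that ord by (simp add: h_def)
    next
      case 6
      then show ?thesis using g3[of s t] that ord by (simp add: h_def)
    qed
  qed
  have gf: "g t = f t" if "t \<in> set ts" for t
    using ts(4)[OF that] by (simp add: g_def)
  have mem: "hd ts \<in> set ts" "last ts \<in> set ts" using ts(2) by auto
  then have rng: "0 \<le> hd ts" "hd ts \<le> c" "0 \<le> last ts" "last ts \<le> c" using ts(3) by auto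
  have "chain_sum (\<lambda>s t. \<bar>f s - f t\<bar>) ts \<le> h (last ts) - h (hd ts)"
  proof (rule chain_sum_le_telescope)
    show "\<bar>f s - f t\<bar> \<le> h t - h s" if "s \<in> set ts" "t \<in> set ts" "s \<le> t" for s t
    proof -
      have "0 \<le> s" "t \<le> c" using that ts(3) by auto
      then show ?thesis using key[of s t] gf that by simp
    qed
  qed (use ts in auto)
  \<comment> \<open>The closing edge is routed through \<open>c\<close>, where \<open>f\<close> has
    the same value as at 0, so that \<open>h\<close> covers the whole turn.\<close>
  moreover have "\<bar>f (last ts) - f (hd ts)\<bar> \<le> \<bar>g (last ts) - g c\<bar> + \<bar>g 0 - g (hd ts)\<bar>"
    using gf mem per by (simp add: g_def[of c] g_def[of 0])
  moreover have "\<bar>g (last ts) - g c\<bar> \<le> h c - h (last ts)" "\<bar>g 0 - g (hd ts)\<bar> \<le> h (hd ts) - h 0"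
    using key rng by auto
  moreover have "h c - h 0 \<le> 2 * (g a - g b)"
  proof -
    have "g c = g 0" by (simp add: g_def per)
    then show ?thesis using ord by (auto simp: h_def)
  qed
  moreover have "g a \<le> u" "l \<le> g b"
    using ts(4)[OF mem(1)] by (auto simp: g_def)
  ultimately show ?thesis
    using ts(2) by (simp add: chain_sum_append)
qed

section \<open>Projections of a segment integrated over all directions\<close>

definition dir :: "real \<Rightarrow> point" where
  "dir t = vector [cos t, sin t]"

lemma dir_nth [simp]: "dir t $ 1 = cos t" "dir t $ 2 = sin t"
  by (simp_all add: dir_def)

lemma inner_dir: "dir s \<bullet> dir t = cos (s - t)"
  by (simp add: inner_vec_def sum_2 cos_diff)

lemma norm_dir [simp]: "norm (dir t) = 1"
  by (simp add: norm_eq_sqrt_inner inner_dir)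

lemma polar_form:
  obtains t where "0 \<le> t" "t < 2 * pi" "(x :: point) = norm x *\<^sub>R dir t"
proof (cases "x = 0")
  case True
  then show ?thesis using that[of 0] by simp
next
  case False
  have nx: "(norm x)\<^sup>2 = (x $ 1)\<^sup>2 + (x $ 2)\<^sup>2"
    unfolding power2_norm_eq_inner by (simp add: inner_vec_def sum_2 power2_eq_square)
  have "(x $ 1 / norm x)\<^sup>2 + (x $ 2 / norm x)\<^sup>2 = (norm x)\<^sup>2 / (norm x)\<^sup>2"
    by (simp only: power_divide nx add_divide_distrib)
  also have "\<dots> = 1" using False by simp
  finally obtain t where t: "0 \<le> t" "t < 2 * pi" "x $ 1 / norm x = cos t" "x $ 2 / norm x = sin t"
    by (rule sincos_total_2pi)
  have "norm x * cos t = x $ 1" "norm x * sin t = x $ 2"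
    using False by (simp_all flip: t(3,4))
  then have "x = norm x *\<^sub>R dir t" by (simp add: vec_eq_iff forall_2)
  with t show ?thesis using that by blast
qed

text \<open>The sign changes at \<open>b\<close>, and the two parts contribute
  \<open>1 - cos b\<close> and \<open>1 + cos b\<close>.\<close>

lemma has_integral_abs_sin_shift:
  assumes "0 \<le> b" "b \<le> pi"
  shows "((\<lambda>t. \<bar>sin (t - b)\<bar>) has_integral 2) {0..pi}"
proof -
  have "((\<lambda>t. sin (b - t)) has_integral cos (b - b) - cos (b - 0)) {0..b}"
    by (rule fundamental_theorem_of_calculus)
      (use assms in \<open>auto intro!: derivative_eq_intros simp: has_real_derivative_iff_has_vector_derivative[symmetric]\<close>)
  moreover have "\<bar>sin (t - b)\<bar> = sin (b - t)" if "t \<in> {0..b}" for t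
  proof -
    have "0 \<le> sin (b - t)" using that assms by (intro sin_ge_zero) auto
    moreover have "sin (t - b) = - sin (b - t)" by (metis minus_diff_eq sin_minus)
    ultimately show ?thesis by simp
  qed
  ultimately have 1: "((\<lambda>t. \<bar>sin (t - b)\<bar>) has_integral cos (b - b) - cos (b - 0)) {0..b}"
    using has_integral_eq by (metis (mono_tags, lifting))
  have "((\<lambda>t. sin (t - b)) has_integral - cos (pi - b) - - cos (b - b)) {b..pi}"
    by (rule fundamental_theorem_of_calculus)
      (use assms in \<open>auto intro!: derivative_eq_intros simp: has_real_derivative_iff_has_vector_derivative[symmetric]\<close>)
  moreover have "\<bar>sin (t - b)\<bar> = sin (t - b)" if "t \<in> {b..pi}" for t
  proof -
    have "0 \<le> sin (t - b)" using that assms by (intro sin_ge_zero) auto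
    then show ?thesis by simp
  qed
  ultimately have 2: "((\<lambda>t. \<bar>sin (t - b)\<bar>) has_integral - cos (pi - b) - - cos (b - b)) {b..pi}"
    using has_integral_eq by (metis (mono_tags, lifting))
  have "cos (pi - b) = - cos b" by simp
  with has_integral_combine[OF assms 1 2] show ?thesis by simp
qed

text \<open>In polar form the integrand is \<open>norm x\<close> times a shifted absolute cosine.
  This has period \<open>pi\<close>, so the integral does not depend on the angle of
  \<open>x\<close>.\<close>

lemma has_integral_abs_inner_dir:
  "((\<lambda>t. \<bar>x \<bullet> dir t\<bar>) has_integral 2 * norm x) {0..pi}"
proof -
  obtain s where s: "0 \<le> s" "s < 2 * pi" "x = norm x *\<^sub>R dir s" by (rule polar_form)
  have "\<exists>b. 0 \<le> b \<and> b \<le> pi \<and> (\<forall>t. \<bar>cos (s - t)\<bar> = \<bar>sin (t - b)\<bar>)"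
  proof -
    have shift: "\<bar>cos (s - t)\<bar> = \<bar>sin (t - (s + pi / 2))\<bar>"
      "\<bar>cos (s - t)\<bar> = \<bar>sin (t - (s - pi / 2))\<bar>"
      "\<bar>cos (s - t)\<bar> = \<bar>sin (t - (s - 3 * pi / 2))\<bar>" for t
    proof -
      have "cos (s - t) = cos (t - s)" by (metis cos_minus minus_diff_eq)
      moreover have "sin (t - (s + pi / 2)) = - cos (t - s)"
        using sin_diff[of "t - s" "pi / 2"] by (simp add: algebra_simps)
      moreover have "sin (t - (s - pi / 2)) = cos (t - s)"
        using sin_add[of "t - s" "pi / 2"] by (simp add: algebra_simps)
      moreover have "sin (t - (s - 3 * pi / 2)) = - cos (t - s)"
      proof -
        have "t - (s - 3 * pi / 2) = (t - s) + 3 / 2 * pi" by simp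
        then show ?thesis by (simp only: sin_add sin_3over2_pi cos_3over2_pi mult_zero_right
            mult_minus1_right add_0_left)
      qed
      ultimately show "\<bar>cos (s - t)\<bar> = \<bar>sin (t - (s + pi / 2))\<bar>"
        "\<bar>cos (s - t)\<bar> = \<bar>sin (t - (s - pi / 2))\<bar>"
        "\<bar>cos (s - t)\<bar> = \<bar>sin (t - (s - 3 * pi / 2))\<bar>"
        by simp_all
    qed
    \<comment> \<open>The cosine vanishes at \<open>s + pi / 2\<close> modulo \<open>pi\<close>; in
      each range of \<open>s\<close> the witness \<open>b\<close> is such a zero inside
      \<open>{0..pi}\<close>.\<close>
    consider "s < pi / 2" | "pi / 2 \<le> s" "s \<le> 3 * pi / 2" | "3 * pi / 2 < s" by linarith
    then show ?thesis
    proof cases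
      case 1
      then show ?thesis using shift(1) s by (intro exI[of _ "s + pi / 2"]) auto
    next
      case 2
      then show ?thesis using shift(2) s by (intro exI[of _ "s - pi / 2"]) auto
    next
      case 3
      then show ?thesis using shift(3) s by (intro exI[of _ "s - 3 * pi / 2"]) auto
    qed
  qed
  then obtain b where b: "0 \<le> b" "b \<le> pi" "\<And>t. \<bar>cos (s - t)\<bar> = \<bar>sin (t - b)\<bar>" by blast
  have "\<bar>x \<bullet> dir t\<bar> = norm x * \<bar>sin (t - b)\<bar>" for t
    by (subst s(3)) (simp add: inner_dir abs_mult b(3))
  then show ?thesis
    using has_integral_mult_right[OF has_integral_abs_sin_shift[OF b(1,2)], of "norm x"]
    by (simp add: mult.commute)
qed

text \<open>Cauchy's formula: the projection of the polygon to the direction \<open>dir x\<close> covers an interval of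
  length at most \<open>D\<close> exactly twice, and integrating over \<open>x\<close> gives twice the perimeter.\<close>

lemma cocircular_perimeter_sorted:
  assumes "0 \<le> r" "sorted ts" "set ts \<subseteq> {0..2 * pi}"
    and diam: "\<And>s t. s \<in> set ts \<Longrightarrow> t \<in> set ts \<Longrightarrow> dist (q + r *\<^sub>R dir s) (q + r *\<^sub>R dir t) \<le> D"
    and "ts \<noteq> []"
  shows "cycle_len (map (\<lambda>t. q + r *\<^sub>R dir t) ts) \<le> pi * D"
proof -
  define c where "c t = q + r *\<^sub>R dir t" for t
  let ?W = "\<lambda>x s t. \<bar>(c s - c t) \<bullet> dir x\<bar>"
  let ?ts = "ts @ [hd ts]"
  have width: "chain_sum (?W x) ?ts \<le> 2 * D" if x: "x \<in> {0..pi}" for x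
  proof -
    let ?f = "\<lambda>t. r * cos (t - x)"
    have W: "?W x s t = \<bar>?f s - ?f t\<bar>" for s t
      by (simp add: c_def inner_diff_left inner_dir)
    define l where "l = Min (?f ` set ts)"
    define u where "u = Max (?f ` set ts)"
    have lu: "l \<le> ?f t \<and> ?f t \<le> u" if "t \<in> set ts" for t
      using that unfolding l_def u_def by (intro conjI Min_le Max_ge) auto
    have "u \<in> ?f ` set ts" "l \<in> ?f ` set ts"
      unfolding l_def u_def using \<open>ts \<noteq> []\<close> by (intro Max_in Min_in; simp)+
    then obtain s t where st: "s \<in> set ts" "t \<in> set ts" "u = ?f s" "l = ?f t"
      by blast
    \<comment> \<open>Both extreme projections come from vertices, so the width is at most the
      distance of two vertices.\<close>
    have "u - l \<le> \<bar>(c s - c t) \<bullet> dir x\<bar>" using W st by simp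
    also have "\<dots> \<le> norm (c s - c t)"
      using Cauchy_Schwarz_ineq2[of "c s - c t" "dir x"] by simp
    also have "\<dots> \<le> D" using diam[OF st(1,2)] by (simp add: c_def dist_norm)
    finally have ul: "u - l \<le> D" .
    have "chain_sum (\<lambda>s t. \<bar>?f s - ?f t\<bar>) ?ts \<le> 2 * (u - l)"
    \<comment> \<open>On the circle, \<open>cos (t - x)\<close> has its maximum at \<open>x\<close>
      and its minimum at \<open>x + pi\<close>; both lie in \<open>{0..2 * pi}\<close> because
      \<open>x\<close> is in \<open>{0..pi}\<close>.\<close>
    proof (rule cyclic_variation[where a = x and b = "x + pi" and c = "2 * pi"])
      show "?f s \<le> ?f t" if "0 \<le> s" "s \<le> t" "t \<le> x" for s t
      proof -
        have "cos (x - s) \<le> cos (x - t)" using that x by (intro cos_monotone_0_pi_le) auto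
        then show ?thesis using \<open>0 \<le> r\<close> by (metis cos_minus minus_diff_eq mult_left_mono)
      qed
      show "?f t \<le> ?f s" if "x \<le> s" "s \<le> t" "t \<le> x + pi" for s t
        using that x \<open>0 \<le> r\<close> by (intro mult_left_mono cos_monotone_0_pi_le) auto
      show "?f s \<le> ?f t" if "x + pi \<le> s" "s \<le> t" "t \<le> 2 * pi" for s t
      proof -
        \<comment> \<open>Reflection at \<open>pi\<close> moves the angles into
          \<open>{0..pi}\<close>, where the cosine decreases.\<close>
        have "cos (2 * pi - (s - x)) \<le> cos (2 * pi - (t - x))"
          using that x by (intro cos_monotone_0_pi_le) auto
        then show ?thesis using \<open>0 \<le> r\<close> by (simp add: mult_left_mono)
      qed
      show "?f (2 * pi) = ?f 0" by (simp add: cos_diff)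
    qed (use x assms lu in auto)
    then show ?thesis using ul W by simp
  qed
  have "((\<lambda>x. chain_sum (?W x) ?ts) has_integral chain_sum (\<lambda>s t. 2 * dist (c s) (c t)) ?ts) {0..pi}"
    by (rule has_integral_chain_sum) (unfold dist_norm, rule has_integral_abs_inner_dir)
  moreover have "((\<lambda>x. 2 * D) has_integral pi * (2 * D)) {0..pi}"
    using has_integral_const_real[of "2 * D" 0 pi] by simp
  ultimately have "chain_sum (\<lambda>s t. 2 * dist (c s) (c t)) ?ts \<le> pi * (2 * D)"
    by (rule has_integral_le) (rule width)
  moreover have "cycle_len (map c ts) = chain_sum (\<lambda>s t. dist (c s) (c t)) ?ts"
    using path_len_map[of c ?ts] \<open>ts \<noteq> []\<close> by (simp add: cycle_len_def hd_map)
  ultimately show ?thesis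
    unfolding c_def by (simp flip: chain_sum_mult)
qed

text \<open>Sorting by polar angle gives the cyclic order. A multiset is used because ends of
  different paths may coincide.\<close>

lemma cocircular_perimeter:
  fixes A :: "point multiset"
  assumes "\<And>a. a \<in># A \<Longrightarrow> dist q a = r"
    and "\<And>a b. a \<in># A \<Longrightarrow> b \<in># A \<Longrightarrow> dist a b \<le> D" and "A \<noteq> {#}"
  obtains cs where "mset cs = A" "cycle_len cs \<le> pi * D"
proof -
  obtain as where as: "mset as = A" using ex_mset by blast
  then have "as \<noteq> []" using assms by auto
  let ?c = "\<lambda>t. q + r *\<^sub>R dir t"
  have "\<exists>t\<in>{0..2 * pi}. a = ?c t" if "a \<in># A" for a
  proof -
    obtain t where t: "0 \<le> t" "t < 2 * pi" "a - q = norm (a - q) *\<^sub>R dir t" by (rule polar_form)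
    have "norm (a - q) = r" using assms(1)[OF that] by (simp add: dist_norm norm_minus_commute)
    with t(3) have "a - q = r *\<^sub>R dir t" by metis
    then have "a = ?c t" by (metis add_diff_cancel_left' add.commute diff_add_cancel)
    then show ?thesis using t by auto
  qed
  then obtain \<theta> where \<theta>: "\<And>a. a \<in># A \<Longrightarrow> \<theta> a \<in> {0..2 * pi}" "\<And>a. a \<in># A \<Longrightarrow> ?c (\<theta> a) = a" by metis
  let ?ts = "sort (map \<theta> as)"
  have "0 \<le> r" using assms by (metis multiset_nonemptyE zero_le_dist)
  have "mset (map ?c ?ts) = image_mset (\<lambda>a. ?c (\<theta> a)) A"
    by (simp add: as image_mset.compositionality comp_def)
  also have "\<dots> = image_mset (\<lambda>a. a) A" by (rule image_mset_cong) (rule \<theta>(2))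
  also have "\<dots> = A" by simp
  finally have m: "mset (map ?c ?ts) = A" .
  have "cycle_len (map ?c ?ts) \<le> pi * D"
  proof (rule cocircular_perimeter_sorted)
    show "set ?ts \<subseteq> {0..2 * pi}" using \<theta>(1) as by auto
    show "dist (?c s) (?c t) \<le> D" if st: "s \<in> set ?ts" "t \<in> set ?ts" for s t
    proof -
      obtain a b where "a \<in># A" "b \<in># A" "s = \<theta> a" "t = \<theta> b"
        using st as by auto
      then show ?thesis using \<theta>(2) assms(2) by simp
    qed
    show "?ts \<noteq> []"
      using \<open>as \<noteq> []\<close> by (metis length_0_conv length_map length_sort)
  qed (use \<open>0 \<le> r\<close> in simp_all)
  then show ?thesis using m that by blast
qed

subsection \<open>Cutting tours at a circle\<close>

text \<open>For \<open>v = q\<close> the junk value \<open>r / 0 = 0\<close> makes this \<open>q\<close>, which is right in the only admissible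
  case \<open>r = 0\<close>.\<close>

definition radial_proj :: "point \<Rightarrow> real \<Rightarrow> point \<Rightarrow> point" where
  "radial_proj q r v = q + (r / dist q v) *\<^sub>R (v - q)"

lemma radial_proj:
  assumes "0 \<le> r" "r \<le> dist q v"
  shows "dist q (radial_proj q r v) = r"
    and "dist q v = r + dist (radial_proj q r v) v"
    and "radial_proj q r v \<in> closed_segment q v"
proof -
  let ?u = "r / dist q v"
  have eq: "radial_proj q r v = (1 - ?u) *\<^sub>R q + ?u *\<^sub>R v"
    by (simp add: radial_proj_def algebra_simps)
  have u: "0 \<le> ?u" "?u \<le> 1" using assms by (auto simp: divide_le_eq)
  have ur: "?u * dist q v = r" using assms by auto
  have "dist q (radial_proj q r v) = ?u * dist q v"
    using \<open>0 \<le> r\<close> by (simp add: radial_proj_def dist_norm norm_minus_commute)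
  then show "dist q (radial_proj q r v) = r" using ur by simp
  have "radial_proj q r v - v = (1 - ?u) *\<^sub>R (q - v)" by (simp add: eq algebra_simps)
  then have "dist (radial_proj q r v) v = (1 - ?u) * dist q v" using u by (simp add: dist_norm)
  then show "dist q v = r + dist (radial_proj q r v) v" using ur by (simp add: algebra_simps)
  show "radial_proj q r v \<in> closed_segment q v"
    using u eq by (auto simp: in_segment)
qed

text \<open>The largest distance in the hull of a finite set is attained at points of the set. This
  bounds distances between cut points, which need not be terminals.\<close>

lemma dist_hull_le_diameter:
  fixes S :: "'a::euclidean_space set"
  assumes "finite S" "x \<in> convex hull S" "y \<in> convex hull S"
  shows "dist x y \<le> diameter S"
proof -
  obtain u v where "u \<in> S" "v \<in> S" "norm (x - y) \<le> norm (u - v)"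
    using simplex_extremal_le_exists[OF assms] by blast
  then show ?thesis
    using diameter_bounded_bound[of S u v] assms(1) by (simp add: dist_norm finite_imp_bounded)
qed

text \<open>This bounds a tour's share of the radial cost, with \<open>c\<close> either half the
  tour cost or the cutting radius.\<close>

lemma average_le:
  assumes "0 < k" "card S \<le> k" "\<And>v. v \<in> S \<Longrightarrow> f v \<le> c" "0 \<le> c"
  shows "2 / real k * (\<Sum>v\<in>S. f v) \<le> 2 * c"
proof -
  have "(\<Sum>v\<in>S. f v) \<le> card S * c" by (rule sum_bounded_above) (use assms in auto)
  also have "\<dots> \<le> k * c" using assms by (intro mult_right_mono) auto
  finally show ?thesis using assms by (simp add: field_simps)
qed

definition outer_path :: "point \<Rightarrow> real \<Rightarrow> point list \<Rightarrow> point list" where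
  "outer_path q r t = radial_proj q r (hd t) # t @ [radial_proj q r (last t)]"

text \<open>The first and last legs are radial, so they pass through the cut points and split there
  without loss.\<close>

lemma tour_cost_outer_path:
  assumes "t \<noteq> []" "0 \<le> r" "\<And>v. v \<in> set t \<Longrightarrow> r \<le> dist q v"
  shows "tour_cost q t = 2 * r + path_len (outer_path q r t)"
proof -
  have "hd t \<in> set t" "last t \<in> set t" using \<open>t \<noteq> []\<close> by auto
  then have "dist q (hd t) = r + dist (radial_proj q r (hd t)) (hd t)"
    "dist q (last t) = r + dist (radial_proj q r (last t)) (last t)"
    using assms by (blast intro: radial_proj(2))+
  then show ?thesis
    using \<open>t \<noteq> []\<close>
    by (simp add: tour_cost_eq outer_path_def path_len_Cons path_len_append_last dist_commute)
qed

section \<open>The lower bound for every feasible solution\<close>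

theorem theorem5:
  fixes V :: "point set" and Ob :: point and k :: nat and R :: ereal
  assumes "finite V" and "k > 0" and "R \<ge> 0"
  shows "cvrp_opt V Ob k \<ge>
           local_cost V Ob R + radial_cost V Ob k R - 3 * pi * diameter (insert Ob V) / 2"
proof -
  let ?D = "diameter (insert Ob V)"
  define f where "f v = real_of_ereal (min (ereal (dist Ob v)) R)" for v
  have fd: "0 \<le> f v" "f v \<le> dist Ob v" for v
    using \<open>R \<ge> 0\<close> by (cases R; simp add: f_def min_def)+
  have D0: "0 \<le> ?D" using \<open>finite V\<close> by (intro diameter_ge_0) (simp add: finite_imp_bounded)
  have bound: "local_cost V Ob R + radial_cost V Ob k R - 3 * pi * ?D / 2 \<le> cvrp_cost Ob sol"
    if feas: "cvrp_feasible V k sol" for sol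
  proof -
    have sub: "set t \<subseteq> V" "card (set t) \<le> k" if "t \<in> set sol" for t
      using feas that by (auto simp: cvrp_feasible_def)
    have cov: "V \<subseteq> (\<Union>t\<in>set sol. set t)" using feas by (simp add: cvrp_feasible_def)
    \<comment> \<open>Only an inequality, since a terminal may lie on several tours.\<close>
    have "sum f V \<le> (\<Sum>t\<leftarrow>sol. \<Sum>v\<in>set t. f v)"
      using cov \<open>finite V\<close>
    proof (induction sol arbitrary: V)
      case (Cons t sol)
      have "sum f V \<le> sum f (set t \<union> (V - set t))"
        using Cons.prems fd by (intro sum_mono2) auto
      also have "\<dots> = sum f (set t) + sum f (V - set t)"
        using Cons.prems by (intro sum.union_disjoint) auto
      also have "sum f (V - set t) \<le> (\<Sum>t\<leftarrow>sol. \<Sum>v\<in>set t. f v)"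
        using Cons.prems by (intro Cons.IH) auto
      finally show ?case by simp
    qed simp
    then have "2 / k * sum f V \<le> 2 / k * (\<Sum>t\<leftarrow>sol. \<Sum>v\<in>set t. f v)"
      by (intro mult_left_mono) auto
    then have rad: "radial_cost V Ob k R \<le> (\<Sum>t\<leftarrow>sol. 2 / k * (\<Sum>v\<in>set t. f v))"
      unfolding sum_list_const_mult by (simp add: radial_cost_def f_def)
    have tour: "2 / k * (\<Sum>v\<in>set t. f v) \<le> tour_cost Ob t" if "t \<in> set sol" for t
    proof -
      have "2 / k * (\<Sum>v\<in>set t. f v) \<le> 2 * (tour_cost Ob t / 2)"
      proof (rule average_le)
        show "f v \<le> tour_cost Ob t / 2" if "v \<in> set t" for v
          using tour_cost_ge_dist[OF that, of Ob] fd(2)[of v] by simp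
      qed (use sub[OF that] \<open>k > 0\<close> tour_cost_nonneg in auto)
      then show ?thesis by simp
    qed
    show ?thesis
    \<comment> \<open>With at most one far terminal the local cost is 0 and the radial bound
      suffices. This covers infinite \<open>R\<close>, where no terminal is far.\<close>
    proof (cases "card {v \<in> V. R \<le> ereal (dist Ob v)} \<le> 1")
      case True
      have "(\<Sum>t\<leftarrow>sol. 2 / k * (\<Sum>v\<in>set t. f v)) \<le> cvrp_cost Ob sol"
        unfolding cvrp_cost_def by (rule sum_list_mono) (rule tour)
      moreover have "local_cost V Ob R = 0" using True by (simp add: local_cost_def tsp_len_def)
      moreover have "0 \<le> 3 * pi * ?D / 2" using D0 by simp
      ultimately show ?thesis using rad by linarith
    next
      case False
      then have "{v \<in> V. R \<le> ereal (dist Ob v)} \<noteq> {}" by force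
      then obtain r where R: "R = ereal r" "0 \<le> r"
        using \<open>R \<ge> 0\<close> by (cases R) auto
      define far where "far = filter (\<lambda>v. r \<le> dist Ob v)"
      have farD: "r \<le> dist Ob v" "v \<in> set t" if "v \<in> set (far t)" for v t
        using that by (auto simp: far_def)
      define P where "P = map (\<lambda>t. outer_path Ob r (far t)) (filter (\<lambda>t. far t \<noteq> []) sol)"
      have cost: "2 / k * (\<Sum>v\<in>set t. f v) + (if far t \<noteq> [] then path_len (outer_path Ob r (far t)) else 0)
          \<le> tour_cost Ob t" if t: "t \<in> set sol" for t
      proof (cases "far t = []")
        case True
        then show ?thesis using tour[OF t] by simp
      next
        case False
        have "2 / k * (\<Sum>v\<in>set t. f v) \<le> 2 * r"
          by (rule average_le) (use sub[OF t] \<open>k > 0\<close> R in \<open>auto simp: f_def min_def\<close>)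
        moreover have "tour_cost Ob (far t) = 2 * r + path_len (outer_path Ob r (far t))"
          by (rule tour_cost_outer_path) (use False R farD in auto)
        moreover have "tour_cost Ob (far t) \<le> tour_cost Ob t"
          unfolding far_def by (rule tour_cost_subseq) simp
        ultimately show ?thesis using False by simp
      qed
      have "(\<Sum>t\<leftarrow>sol. 2 / k * (\<Sum>v\<in>set t. f v)) + (\<Sum>p\<leftarrow>P. path_len p)
        = (\<Sum>t\<leftarrow>sol. 2 / k * (\<Sum>v\<in>set t. f v) + (if far t \<noteq> [] then path_len (outer_path Ob r (far t)) else 0))"
        by (simp add: P_def sum_list_addf sum_list_map_filter' comp_def)
      also have "\<dots> \<le> cvrp_cost Ob sol"
        unfolding cvrp_cost_def by (rule sum_list_mono) (rule cost)
      finally have total: "radial_cost V Ob k R + (\<Sum>p\<leftarrow>P. path_len p) \<le> cvrp_cost Ob sol"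
        using rad by simp
      have S: "{v \<in> V. R \<le> ereal (dist Ob v)} \<subseteq> (\<Union>p\<in>set P. set p)"
      proof
        fix v assume "v \<in> {v \<in> V. R \<le> ereal (dist Ob v)}"
        then obtain t where "t \<in> set sol" "v \<in> set (far t)"
          using cov R by (auto simp: far_def)
        then show "v \<in> (\<Union>p\<in>set P. set p)"
          by (force simp: P_def outer_path_def)
      qed
      then have "P \<noteq> []" using \<open>{v \<in> V. R \<le> ereal (dist Ob v)} \<noteq> {}\<close> by auto
      define A where "A = (\<Sum>p\<leftarrow>P. ends p)"
      \<comment> \<open>A cut point lies on the segment from the depot to a terminal, hence in the
        hull as well as on the circle.\<close>
      have mem: "dist Ob a = r \<and> a \<in> convex hull insert Ob V" if a: "a \<in># A" for a
      proof -
        obtain p where "p \<in> set P" "a \<in># ends p"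
          using a unfolding A_def by (induction P) auto
        then obtain t where t: "t \<in> set sol" "far t \<noteq> []" "a \<in># ends (outer_path Ob r (far t))"
          by (auto simp: P_def)
        have "hd (far t) \<in> set (far t)" "last (far t) \<in> set (far t)" using t(2) by auto
        with t(3) obtain v where v: "v \<in> set (far t)" "a = radial_proj Ob r v"
          by (auto simp: ends_def outer_path_def)
        have vV: "v \<in> V" using farD(2)[OF v(1)] sub(1)[OF t(1)] by auto
        have rv: "r \<le> dist Ob v" using farD v by auto
        have "closed_segment Ob v \<subseteq> convex hull insert Ob V"
          using vV by (intro closed_segment_subset) (auto intro: hull_inc)
        then show ?thesis using v radial_proj[OF \<open>0 \<le> r\<close> rv] by auto
      qed
      have "A \<noteq> {#}" using \<open>P \<noteq> []\<close> by (cases P) (auto simp: A_def ends_def)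
      then obtain cs where cs: "mset cs = A" "cycle_len cs \<le> pi * ?D"
        using cocircular_perimeter[of A Ob r ?D] mem dist_hull_le_diameter[of "insert Ob V"] \<open>finite V\<close>
        by (metis finite_insert)
      obtain w where w: "w \<noteq> []" "hd w = last w" "(\<Union>p\<in>set P. set p) \<subseteq> set w"
        "path_len w \<le> (\<Sum>p\<leftarrow>P. path_len p) + 3 / 2 * cycle_len cs"
      proof (rule walk_through_paths)
        show "p \<noteq> []" if "p \<in> set P" for p using that by (auto simp: P_def outer_path_def)
      qed (use cs \<open>P \<noteq> []\<close> in \<open>auto simp: A_def\<close>)
      have "local_cost V Ob R \<le> path_len w"
        unfolding local_cost_def
        by (rule tsp_len_le_closed_walk) (use w S in auto)
      then show ?thesis using w(4) cs(2) total by simp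
    qed
  qed
  \<comment> \<open>One tour per terminal is feasible, so the infimum is over a nonempty set, as
    \<open>cInf_greatest\<close> requires.\<close>
  have "\<exists>sol. cvrp_feasible V k sol"
  proof -
    obtain vs where "set vs = V" using \<open>finite V\<close> finite_list by blast
    then show ?thesis
      using \<open>k > 0\<close> by (intro exI[of _ "map (\<lambda>v. [v]) vs"]) (auto simp: cvrp_feasible_def)
  qed
  then show ?thesis
    unfolding cvrp_opt_def by (intro cInf_greatest) (use bound in auto)
qed

end
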